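(* Let $G$ be a group and $H\le G$ a subgroup. Suppose that for every finite index normal subgroup $K$ of $H$ there exists a finite index subgroup $L$ of $G$ (not necessarily normal in $G$) such that $H\cap L=K$. If $F$ is a finite group and there is a surjective homomorphism from $H$ onto $F$, then $G$ has $F$ as a virtual image.
   Context: A group $G$ has the finite group $F$ as a virtual image if there is a finite index subgroup of $G$ which admits a surjective homomorphism onto $F$. *)

theory Defs
  imports "HOL-Algebra.Algebra"
begin

definition finite_index_subgroup :: "'a set \<Rightarrow> ('a, 'm) monoid_scheme \<Rightarrow> bool" where
  "finite_index_subgroup L G \<longleftrightarrow> subgroup L G \<and> finite (rcosets\<^bsub>G\<^esub> L)"

definition has_virtual_image :: "('a, 'm) monoid_scheme \<Rightarrow> ('b, 'n) monoid_scheme \<Rightarrow> bool" where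
  "has_virtual_image G F \<longleftrightarrow>
    (\<exists>L. finite_index_subgroup L G \<and> (\<exists>f. f \<in> epi (G\<lparr>carrier := L\<rparr>) F))"

end

theory Submission
  imports Defs
begin

text \<open>Let \<open>K\<close> be the kernel of \<open>f : H \<rightarrow> F\<close> and \<open>H \<inter> L = K\<close> with \<open>L\<close> of finite index. The normal
  core \<open>N\<close> of \<open>L\<close> has finite index and satisfies \<open>H \<inter> N \<subseteq> K\<close>, so \<open>h n \<mapsto> f h\<close> is a well-defined
  homomorphism from \<open>H N\<close> onto \<open>F\<close>.\<close>

text \<open>The coset of an element depends only on its value under \<open>\<phi>\<close>, so one
  chosen preimage per value reaches every coset. \<open>\<phi>\<close> is an arbitrary map, so that
  coset maps, actions and homomorphisms can all be plugged in.\<close>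

lemma (in group) finite_rcosets_if_finite_image:
  assumes K: "subgroup K G" and fin: "finite (\<phi> ` carrier G)"
    and sep: "\<And>x y. x \<in> carrier G \<Longrightarrow> y \<in> carrier G \<Longrightarrow> \<phi> x = \<phi> y \<Longrightarrow> x \<otimes> inv y \<in> K"
  shows "finite (rcosets K)"
proof -
  have "K #> inv_into (carrier G) \<phi> (\<phi> x) = K #> x" if x: "x \<in> carrier G" for x
  proof -
    define y where "y = inv_into (carrier G) \<phi> (\<phi> x)"
    have y: "y \<in> carrier G" "\<phi> y = \<phi> x"
      unfolding y_def using x by (auto intro: inv_into_into f_inv_into_f)
    then have "x \<otimes> inv y \<in> K" using sep x by simp
    then have "K #> (x \<otimes> inv y) = K" using K coset_join2 x y by simp
    then have "K #> x = K #> y" using K x y coset_mult_inv1 subgroup.subset by blast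
    then show ?thesis unfolding y_def by simp
  qed
  then have "rcosets K \<subseteq> (\<lambda>v. K #> inv_into (carrier G) \<phi> v) ` \<phi> ` carrier G"
    unfolding RCOSETS_def by (auto simp: image_iff)
  then show ?thesis using fin finite_subset by blast
qed

lemma (in group) rcos_eq_imp_mult_inv_mem:
  assumes K: "subgroup K G" and x: "x \<in> carrier G" and y: "y \<in> carrier G"
    and eq: "K #> x = K #> y"
  shows "x \<otimes> inv y \<in> K"
proof -
  have "x \<in> K #> y" using rcos_self[OF x K] eq by simp
  then obtain k where "k \<in> K" "x = k \<otimes> y" unfolding r_coset_def by auto
  then show ?thesis using K y subgroup.mem_carrier by (fastforce simp: m_assoc)
qed

lemma (in group) finite_rcosets_mono:
  assumes N: "subgroup N G" and M: "subgroup M G" and "N \<subseteq> M" and fin: "finite (rcosets N)"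
  shows "finite (rcosets M)"
proof (rule finite_rcosets_if_finite_image[OF M, where \<phi> = "\<lambda>x. N #> x"])
  have "(\<lambda>x. N #> x) ` carrier G = rcosets N" unfolding RCOSETS_def by auto
  then show "finite ((\<lambda>x. N #> x) ` carrier G)" using fin by simp
qed (use rcos_eq_imp_mult_inv_mem[OF N] \<open>N \<subseteq> M\<close> in blast)

text \<open>The core is the kernel of the action of the group by right multiplication on the cosets
  of \<open>L\<close>. These are finitely many, so they have only finitely many self-maps.\<close>

lemma (in group) normal_core_finite_index:
  assumes L: "subgroup L G" and fin: "finite (rcosets L)"
  obtains N where "N \<lhd> G" "N \<subseteq> L" "finite (rcosets N)"
proof
  interpret L: subgroup L G by (rule L)
  define N where "N = {g \<in> carrier G. \<forall>x\<in>carrier G. x \<otimes> g \<otimes> inv x \<in> L}"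
  have mult: "x \<otimes> (a \<otimes> b) \<otimes> inv x = (x \<otimes> a \<otimes> inv x) \<otimes> (x \<otimes> b \<otimes> inv x)"
    and inv: "x \<otimes> inv a \<otimes> inv x = inv (x \<otimes> a \<otimes> inv x)"
    and conj: "x \<otimes> (b \<otimes> a \<otimes> inv b) \<otimes> inv x = (x \<otimes> b) \<otimes> a \<otimes> inv (x \<otimes> b)"
    if "x \<in> carrier G" "a \<in> carrier G" "b \<in> carrier G" for x a b
    using that by (simp_all add: m_assoc inv_mult_group inv_solve_left)
  have sub: "subgroup N G"
    by (rule subgroupI) (auto simp: N_def mult inv intro!: exI[of _ \<one>])
  then show "N \<lhd> G"
    unfolding normal_inv_iff by (auto simp: N_def conj)
  show "N \<subseteq> L"
    using one_closed by (force simp: N_def dest: bspec[OF _ one_closed])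
  \<comment> \<open>\<open>\<phi> g\<close> is the action of \<open>g\<close>. Restricting it to
    \<open>rcosets L\<close> puts it into an extensional function space, which is finite.\<close>
  define \<phi> where "\<phi> g = (\<lambda>C\<in>rcosets L. C #> g)" for g
  show "finite (rcosets N)"
  proof (rule finite_rcosets_if_finite_image[OF sub, where \<phi> = \<phi>])
    have "\<phi> ` carrier G \<subseteq> (rcosets L) \<rightarrow>\<^sub>E (rcosets L)"
      unfolding \<phi>_def RCOSETS_def by (force simp: coset_mult_assoc L.subset)
    then show "finite (\<phi> ` carrier G)"
      using fin finite_PiE finite_subset by metis
  next
    fix g g' assume g: "g \<in> carrier G" "g' \<in> carrier G" and eq: "\<phi> g = \<phi> g'"
    \<comment> \<open>Equal actions are compared at the single coset \<open>L #> x\<close>; letting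
      \<open>x\<close> vary gives membership in the core.\<close>
    have "x \<otimes> (g \<otimes> inv g') \<otimes> inv x \<in> L" if x: "x \<in> carrier G" for x
    proof -
      have "L #> x \<in> rcosets L" using x by (simp add: L.subset rcosetsI)
      then have "(L #> x) #> g = (L #> x) #> g'"
        using eq unfolding \<phi>_def by (metis restrict_apply')
      then have "L #> (x \<otimes> g) = L #> (x \<otimes> g')"
        using x g by (simp add: coset_mult_assoc L.subset)
      then have "(x \<otimes> g) \<otimes> inv (x \<otimes> g') \<in> L"
        using rcos_eq_imp_mult_inv_mem[OF L] x g by simp
      then show ?thesis using x g by (simp add: m_assoc inv_mult_group)
    qed
    then show "g \<otimes> inv g' \<in> N" using g by (simp add: N_def)
  qed
qed

lemma (in group_hom) kernel_finite_index:
  assumes "finite (carrier H)"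
  shows "finite (rcosets (kernel G H h))"
proof (rule G.finite_rcosets_if_finite_image[OF subgroup_kernel, where \<phi> = h])
  show "finite (h ` carrier G)"
    using assms finite_subset homh by (metis hom_carrier)
qed (auto simp: kernel_def)

text \<open>The assumption on \<open>H \<inter> N\<close> makes the value at
  \<open>h \<otimes> n\<close> independent of the factorization; normality of \<open>N\<close> makes
  the extension multiplicative.\<close>

lemma (in group) epi_extends_to_normal_product:
  assumes H: "subgroup H G" and N: "N \<lhd> G" and F: "group F"
    and f: "f \<in> epi (G\<lparr>carrier := H\<rparr>) F"
    and ker: "H \<inter> N \<subseteq> kernel (G\<lparr>carrier := H\<rparr>) F f"
  shows "\<exists>g. g \<in> epi (G\<lparr>carrier := H <#> N\<rparr>) F"
proof -
  interpret H: subgroup H G by (rule H)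
  interpret N: normal N G by (rule N)
  interpret F: group F by (rule F)
  interpret f: group_hom "G\<lparr>carrier := H\<rparr>" F f
    using f H.subgroup_is_group[OF is_group] F by (simp add: group_hom_def group_hom_axioms_def epi_def)
  \<comment> \<open>An arbitrary \<open>H\<close>-component is chosen; the next fact shows that the
    choice does not affect the value.\<close>
  define g where "g x = f (SOME h. h \<in> H \<and> (\<exists>n\<in>N. x = h \<otimes> n))" for x
  have g: "g (h \<otimes> n) = f h" if h: "h \<in> H" and n: "n \<in> N" for h n
  proof -
    define h' where "h' = (SOME k. k \<in> H \<and> (\<exists>m\<in>N. h \<otimes> n = k \<otimes> m))"
    have "h' \<in> H \<and> (\<exists>m\<in>N. h \<otimes> n = h' \<otimes> m)"
      unfolding h'_def by (rule someI[of _ h]) (use h n in blast)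
    then obtain m where h': "h' \<in> H" and m: "m \<in> N" and eq: "h \<otimes> n = h' \<otimes> m" by blast
    \<comment> \<open>The left side lies in \<open>H\<close> and the right side in \<open>N\<close>,
      so this quotient of the two \<open>H\<close>-components is killed by \<open>f\<close>.\<close>
    have "inv h' \<otimes> h = m \<otimes> inv n"
    proof -
      have "inv h' \<otimes> (h \<otimes> n) = m" using eq h' m by (simp add: m_assoc[symmetric])
      then show ?thesis using h h' n m by (metis H.mem_carrier N.mem_carrier inv_closed inv_solve_right m_assoc m_closed)
    qed
    then have "inv h' \<otimes> h \<in> H \<inter> N" using h h' n m by (metis IntI H.m_closed H.m_inv_closed N.m_closed N.m_inv_closed)
    then have "f (inv h' \<otimes> h) = \<one>\<^bsub>F\<^esub>" using ker by (auto simp: kernel_def)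
    moreover have "f h = f h' \<otimes>\<^bsub>F\<^esub> f (inv h' \<otimes> h)"
      using f.hom_mult[of h' "inv h' \<otimes> h"] h h' by (simp add: m_assoc[symmetric])
    ultimately have "f h = f h'" using f.hom_closed[of h'] h' by simp
    then show ?thesis unfolding g_def h'_def by simp
  qed
  have cancel: "x \<otimes> (inv x \<otimes> y) = y" if "x \<in> carrier G" "y \<in> carrier G" for x y
    using that by (simp add: m_assoc[symmetric])
  \<comment> \<open>Moving \<open>n\<close> past \<open>h'\<close> conjugates it, and the conjugate
    stays in \<open>N\<close>. Hence \<open>h \<otimes> h'\<close> is an \<open>H\<close>-component
    of the product.\<close>
  have prod: "(h \<otimes> n) \<otimes> (h' \<otimes> n') = (h \<otimes> h') \<otimes> ((inv h' \<otimes> n \<otimes> h') \<otimes> n')"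
    if "h \<in> H" "h' \<in> H" "n \<in> N" "n' \<in> N" for h h' n n'
    using that by (simp add: m_assoc cancel)
  have "g \<in> hom (G\<lparr>carrier := H <#> N\<rparr>) F"
  proof (rule homI)
    fix x assume "x \<in> carrier (G\<lparr>carrier := H <#> N\<rparr>)"
    then show "g x \<in> carrier F"
      using f.hom_closed by (auto simp: set_mult_def g)
  next
    fix x y assume "x \<in> carrier (G\<lparr>carrier := H <#> N\<rparr>)" "y \<in> carrier (G\<lparr>carrier := H <#> N\<rparr>)"
    then obtain h n h' n' where *: "h \<in> H" "n \<in> N" "x = h \<otimes> n" "h' \<in> H" "n' \<in> N" "y = h' \<otimes> n'"
      by (auto simp: set_mult_def)
    moreover have "(inv h' \<otimes> n \<otimes> h') \<otimes> n' \<in> N"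
      using * N.inv_op_closed1 by simp
    ultimately show "g (x \<otimes>\<^bsub>G\<lparr>carrier := H <#> N\<rparr>\<^esub> y) = g x \<otimes>\<^bsub>F\<^esub> g y"
      using f.hom_mult by (simp add: prod g)
  qed
  moreover have "g ` (H <#> N) = f ` H"
  proof -
    have "g ` (H <#> N) \<subseteq> f ` H" by (auto simp: set_mult_def g)
    moreover have "f h \<in> g ` (H <#> N)" if "h \<in> H" for h
    proof (rule image_eqI)
      show "f h = g (h \<otimes> \<one>)" using that by (simp only: g N.one_closed)
      show "h \<otimes> \<one> \<in> H <#> N" using that N.one_closed unfolding set_mult_def by blast
    qed
    ultimately show ?thesis by blast
  qed
  ultimately show ?thesis using f by (auto simp: epi_def)
qed

theorem theorem2p4:
  fixes G :: "('a, 'm) monoid_scheme" and F :: "('b, 'n) monoid_scheme" and H :: "'a set"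
  assumes "group G" and "subgroup H G"
    and "\<And>K. K \<lhd> (G\<lparr>carrier := H\<rparr>) \<Longrightarrow> finite_index_subgroup K (G\<lparr>carrier := H\<rparr>) \<Longrightarrow>
          \<exists>L. finite_index_subgroup L G \<and> H \<inter> L = K"
    and "group F" and "finite (carrier F)"
    and "\<exists>f. f \<in> epi (G\<lparr>carrier := H\<rparr>) F"
  shows "has_virtual_image G F"
proof -
  interpret group G by (rule assms(1))
  interpret H: subgroup H G by (rule assms(2))
  from assms(6) obtain f where f: "f \<in> epi (G\<lparr>carrier := H\<rparr>) F" by blast
  interpret f: group_hom "G\<lparr>carrier := H\<rparr>" F f
    using f H.subgroup_is_group[OF is_group] assms(4)
    by (simp add: group_hom_def group_hom_axioms_def epi_def)
  define K where "K = kernel (G\<lparr>carrier := H\<rparr>) F f"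
  \<comment> \<open>Finiteness of \<open>F\<close> enters here, making the separation hypothesis
    applicable to \<open>K\<close>.\<close>
  have "finite_index_subgroup K (G\<lparr>carrier := H\<rparr>)"
    unfolding finite_index_subgroup_def K_def
    using f.subgroup_kernel f.kernel_finite_index[OF assms(5)] by blast
  then obtain L where L: "finite_index_subgroup L G" and HL: "H \<inter> L = K"
    using assms(3) f.normal_kernel unfolding K_def by blast
  \<comment> \<open>As \<open>L\<close> need not be normal, its product with \<open>H\<close> might
    not be a subgroup; the core avoids this.\<close>
  from L obtain N where N: "N \<lhd> G" "N \<subseteq> L" "finite (rcosets\<^bsub>G\<^esub> N)"
    unfolding finite_index_subgroup_def using normal_core_finite_index by metis
  interpret N: normal N G by (rule N(1))
  have HN: "subgroup (H <#>\<^bsub>G\<^esub> N) G"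
    using mult_norm_subgroup[OF N(1) assms(2)] commut_normal[OF assms(2) N(1)] by simp
  have "n \<in> H <#>\<^bsub>G\<^esub> N" if "n \<in> N" for n
  proof -
    have "n = \<one>\<^bsub>G\<^esub> \<otimes>\<^bsub>G\<^esub> n" using that by simp
    then show ?thesis unfolding set_mult_def using that H.one_closed by blast
  qed
  then have "N \<subseteq> H <#>\<^bsub>G\<^esub> N" by blast
  then have "finite_index_subgroup (H <#>\<^bsub>G\<^esub> N) G"
    unfolding finite_index_subgroup_def
    using HN finite_rcosets_mono[OF N.subgroup_axioms HN _ N(3)] by blast
  \<comment> \<open>The kernel condition holds because \<open>H \<inter> N\<close> is contained in
    \<open>H \<inter> L\<close>, which is \<open>K\<close>.\<close>
  moreover have "\<exists>g. g \<in> epi (G\<lparr>carrier := H <#>\<^bsub>G\<^esub> N\<rparr>) F"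
    using epi_extends_to_normal_product[OF assms(2) N(1) assms(4) f] N(2) HL K_def by blast
  ultimately show ?thesis unfolding has_virtual_image_def by blast
qed

end
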